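(* Let $N\ge 1$, let $s=[\,s_0\ s_1\ \cdots\ s_{N-1}\,]^T\in\mathbb{C}^N$ be arbitrary, and let $\delta\in\mathbb{C}$, $\delta\neq 0$, satisfy $|\delta|\ge\|s\|_1$. Then the augmented signal $$s_{\min}=[\,\delta\ s_0\ \cdots\ s_{N-1}\,]^T\in\mathbb{C}^{N+1}$$ is minimum phase.
   Context: $\|s\|_1=\sum_{n=0}^{N-1}|s_n|$. The $z$-transform of a signal $x=[x_0\ \cdots\ x_K]^T\in\mathbb{C}^{K+1}$ is $X(z)=\sum_{n=0}^{K}x_nz^{-n}$. If $x_0\ne 0$, it factors as $X(z)=x_0\prod_{n=1}^{K}(1-\xi_nz^{-1})$, where the zeros $\xi_1,\dots,\xi_K$ of $X$ are the roots of the polynomial $z^KX(z)=x_0z^K+x_1z^{K-1}+\cdots+x_K$. The signal $x$ (with $x_0\neq0$) is called minimum phase if all these zeros lie inside the unit circle, zeros on the unit circle being allowed, i.e. $|\xi_n|\le 1$ for all $n$. *)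

theory Defs
  imports
    Complex_Main
    "HOL-Computational_Algebra.Polynomial"
begin

text \<open>A signal \<open>[x\<^sub>0, \<dots>, x\<^sub>K]\<close> in \<open>\<complex>\<^sup>K\<^sup>+\<^sup>1\<close> is a list of length \<open>K + 1\<close>, with \<open>x\<^sub>n = x ! n\<close>.\<close>

type_synonym signal = "complex list"

definition l1_norm :: "signal \<Rightarrow> real" where
  "l1_norm s = (\<Sum>n<length s. cmod (s ! n))"

definition z_transform :: "signal \<Rightarrow> complex \<Rightarrow> complex" where
  "z_transform x z = (\<Sum>n<length x. x ! n * inverse z ^ n)"

text \<open>For \<open>K = length x - 1\<close> this is \<open>z\<^sup>K X(z) = x\<^sub>0 z\<^sup>K + x\<^sub>1 z\<^sup>K\<^sup>-\<^sup>1 + \<dots> + x\<^sub>K\<close> as a polynomial in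
  \<open>z\<close>; as such it also makes sense at \<open>z = 0\<close>, where \<open>X(z)\<close> itself does not.\<close>

definition z_poly :: "signal \<Rightarrow> complex poly" where
  "z_poly x = (\<Sum>n<length x. monom (x ! n) (length x - 1 - n))"

lemma poly_z_poly:
  assumes "z \<noteq> 0"
  shows "poly (z_poly x) z = z ^ (length x - 1) * z_transform x z"
  unfolding z_poly_def z_transform_def poly_sum sum_distrib_left
proof (rule sum.cong[OF refl])
  fix n assume "n \<in> {..<length x}"
  hence "z ^ (length x - 1) = z ^ (length x - 1 - n) * z ^ n"
    by (simp flip: power_add)
  thus "poly (monom (x ! n) (length x - 1 - n)) z
      = z ^ (length x - 1) * (x ! n * inverse z ^ n)"
    using assms by (simp add: poly_monom power_inverse)
qed

definition zeros :: "signal \<Rightarrow> complex set" where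
  "zeros x = {\<xi>. poly (z_poly x) \<xi> = 0}"

text \<open>Zeros on the unit circle are allowed.\<close>

definition minimum_phase :: "signal \<Rightarrow> bool" where
  "minimum_phase x \<longleftrightarrow> x \<noteq> [] \<and> x ! 0 \<noteq> 0 \<and> (\<forall>\<xi>\<in>zeros x. cmod \<xi> \<le> 1)"

end

theory Submission
  imports Defs
begin

text \<open>
  Prepending \<open>\<delta>\<close> delays \<open>s\<close> by one sample, so the \<open>z\<close>-transform of the augmented signal is
  \<open>\<delta> + z\<^sup>-\<^sup>1 S(z)\<close>. On and outside the unit circle \<open>\<bar>S(z)\<bar> \<le> \<parallel>s\<parallel>\<^sub>1\<close>, so at a zero \<open>\<xi>\<close> with \<open>\<bar>\<xi>\<bar> > 1\<close>
  the two terms could cancel only if \<open>\<bar>\<delta>\<bar> \<bar>\<xi>\<bar> = \<bar>S(\<xi>)\<bar> \<le> \<parallel>s\<parallel>\<^sub>1 \<le> \<bar>\<delta>\<bar>\<close>, which is impossible for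
  \<open>\<delta> \<noteq> 0\<close>. The delay supplies the factor \<open>\<bar>\<xi>\<bar>\<close> that makes this contradiction strict, even when
  \<open>\<bar>\<delta>\<bar> = \<parallel>s\<parallel>\<^sub>1\<close>.
\<close>

lemma z_transform_Cons:
  "z_transform (a # s) z = a + inverse z * z_transform s z"
  unfolding z_transform_def
  by (simp add: sum.lessThan_Suc_shift sum_distrib_left algebra_simps del: sum.lessThan_Suc)

text \<open>On and outside the unit circle, the powers \<open>z\<^sup>-\<^sup>n\<close> that weight the samples have modulus at most 1.\<close>

lemma norm_z_transform_le_l1_norm:
  assumes "cmod z \<ge> 1"
  shows "cmod (z_transform s z) \<le> l1_norm s"
  unfolding z_transform_def l1_norm_def
proof (rule sum_norm_le)
  fix n
  have "cmod (inverse z) \<le> 1"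
    using assms by (simp add: norm_inverse inverse_le_1_iff)
  hence "cmod (inverse z) ^ n \<le> 1"
    by (simp add: power_le_one)
  thus "cmod (s ! n * inverse z ^ n) \<le> cmod (s ! n)"
    unfolding norm_mult norm_power by (simp add: mult_left_le)
qed

theorem proposition1:
  fixes N :: nat and s :: signal and \<delta> :: complex
  assumes "N \<ge> 1" and "length s = N"
    and "\<delta> \<noteq> 0" and "cmod \<delta> \<ge> l1_norm s"
  shows "minimum_phase (\<delta> # s)"
proof -
  have "cmod \<xi> \<le> 1" if "\<xi> \<in> zeros (\<delta> # s)" for \<xi>
  proof (rule ccontr)
    assume "\<not> cmod \<xi> \<le> 1"
    hence outside: "cmod \<xi> > 1" by simp
    hence "\<xi> \<noteq> 0" by auto
    with that have "\<delta> + inverse \<xi> * z_transform s \<xi> = 0"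
      by (simp add: zeros_def poly_z_poly z_transform_Cons)
    with \<open>\<xi> \<noteq> 0\<close> have "\<delta> * \<xi> = - z_transform s \<xi>"
      by (simp add: field_simps eq_neg_iff_add_eq_0)
    hence "cmod \<delta> * cmod \<xi> = cmod (z_transform s \<xi>)"
      by (metis norm_mult norm_minus_cancel)
    also have "\<dots> \<le> cmod \<delta>"
      using norm_z_transform_le_l1_norm[of \<xi> s] outside assms(4) by linarith
    finally show False
      using outside \<open>\<delta> \<noteq> 0\<close> by simp
  qed
  thus ?thesis
    using \<open>\<delta> \<noteq> 0\<close> by (simp add: minimum_phase_def)
qed

end
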